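(* Let $n \ge 1$, $T \ge 1$ and $k \ge 2$ be integers, and let each customer $i \in \{1,\dots,n\}$ have a score $(R_i,F_i,M_i) \in \{1,\dots,T\}^3$. Let $G$ be the weighted customer graph built from these scores. Then the max-$k$-cut problem (BQO) with input $G$ has at least one optimal solution that is a segmentation solution, i.e. there is an optimal solution $x^*$ of (BQO) for $G$ such that for all $i,j \in \{1,\dots,n\}$ with $(R_i,F_i,M_i) = (R_j,F_j,M_j)$ one has $x^*_{il} = x^*_{jl}$ for every $l \in \{1,\dots,k\}$.
   Context: Customer graph $G$: $G=(V,E)$ is the simple weighted graph with vertex set $V=\{1,\dots,n\}$ (one vertex per customer). For vertices $i \neq j$ put $w_{ij} = |R_i-R_j| + |F_i-F_j| + |M_i-M_j|$. Vertices $i \ne j$ are joined by an edge $e_{ij}$, of weight $w_{ij}$, exactly when their scores differ (customers with the same score have $w_{ij}=0$ and are not joined by an edge). Problem (BQO): for a simple graph with vertices $1,\dots,n$, edge set $E$ and non-negative edge weights $w_{ij}$, and for an integer $k\ge 2$, maximize $$f(x) = \sum_{e_{ij}\in E} w_{ij}\left(1 - \sum_{l=1}^k x_{il}x_{jl}\right)$$ subject to $\sum_{l=1}^k x_{il} = 1$ for $i=1,\dots,n$ and $x_{il}\in\{0,1\}$ for all $i=1,\dots,n$, $l=1,\dots,k$. Each edge (unordered pair) is counted once. The variable $x_{il}$ equals $1$ iff vertex $i$ is assigned to group $V_l$; groups may be empty. Segmentation solution: a feasible solution of (BQO) for $G$ such that vertices having the same score $(R,F,M)$ lie in the same group. *)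

theory Defs
  imports Complex_Main
begin

text \<open>
  A weighted simple graph on the vertices 1, ..., n is given by its set of edges, each a
  two-element set of vertices, and a symmetric weight function, which is only used on edges.
  Only the entries x i l with i in {1..n} and l in {1..k} of an assignment matrix matter;
  x i l = 1 means that vertex i is put into group l.
\<close>

definition bqo_feasible :: "nat \<Rightarrow> nat \<Rightarrow> (nat \<Rightarrow> nat \<Rightarrow> real) \<Rightarrow> bool" where
  "bqo_feasible n k x \<longleftrightarrow>
     (\<forall>i\<in>{1..n}. (\<Sum>l=1..k. x i l) = 1) \<and>
     (\<forall>i\<in>{1..n}. \<forall>l\<in>{1..k}. x i l \<in> {0, 1})"

text \<open>The condition i < j makes every unordered edge contribute exactly once.\<close>

definition bqo_objective ::
  "nat \<Rightarrow> nat \<Rightarrow> nat set set \<Rightarrow> (nat \<Rightarrow> nat \<Rightarrow> real) \<Rightarrow> (nat \<Rightarrow> nat \<Rightarrow> real) \<Rightarrow> real" where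
  "bqo_objective n k E w x =
     (\<Sum>(i, j) \<in> {(i, j). i \<in> {1..n} \<and> j \<in> {1..n} \<and> i < j \<and> {i, j} \<in> E}.
        w i j * (1 - (\<Sum>l=1..k. x i l * x j l)))"

definition bqo_optimal ::
  "nat \<Rightarrow> nat \<Rightarrow> nat set set \<Rightarrow> (nat \<Rightarrow> nat \<Rightarrow> real) \<Rightarrow> (nat \<Rightarrow> nat \<Rightarrow> real) \<Rightarrow> bool" where
  "bqo_optimal n k E w x \<longleftrightarrow>
     bqo_feasible n k x \<and>
     (\<forall>y. bqo_feasible n k y \<longrightarrow> bqo_objective n k E w y \<le> bqo_objective n k E w x)"

definition customer_weight ::
  "(nat \<Rightarrow> nat) \<Rightarrow> (nat \<Rightarrow> nat) \<Rightarrow> (nat \<Rightarrow> nat) \<Rightarrow> nat \<Rightarrow> nat \<Rightarrow> real" where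
  "customer_weight R F M i j =
     \<bar>real (R i) - real (R j)\<bar> + \<bar>real (F i) - real (F j)\<bar> + \<bar>real (M i) - real (M j)\<bar>"

definition customer_edges ::
  "nat \<Rightarrow> (nat \<Rightarrow> nat) \<Rightarrow> (nat \<Rightarrow> nat) \<Rightarrow> (nat \<Rightarrow> nat) \<Rightarrow> nat set set" where
  "customer_edges n R F M =
     {{i, j} | i j. i \<in> {1..n} \<and> j \<in> {1..n} \<and> i \<noteq> j \<and> (R i, F i, M i) \<noteq> (R j, F j, M j)}"

definition segmentation_solution ::
  "nat \<Rightarrow> nat \<Rightarrow> (nat \<Rightarrow> nat) \<Rightarrow> (nat \<Rightarrow> nat) \<Rightarrow> (nat \<Rightarrow> nat) \<Rightarrow> (nat \<Rightarrow> nat \<Rightarrow> real) \<Rightarrow> bool" where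
  "segmentation_solution n k R F M x \<longleftrightarrow>
     bqo_feasible n k x \<and>
     (\<forall>i\<in>{1..n}. \<forall>j\<in>{1..n}. (R i, F i, M i) = (R j, F j, M j) \<longrightarrow>
        (\<forall>l\<in>{1..k}. x i l = x j l))"

lemma customer_weight_nonneg: "0 \<le> customer_weight R F M i j"
  by (simp add: customer_weight_def)

lemma customer_weight_sym: "customer_weight R F M i j = customer_weight R F M j i"
  by (simp add: customer_weight_def abs_minus_commute)

lemma customer_edges_simple:
  "e \<in> customer_edges n R F M \<Longrightarrow> e \<subseteq> {1..n} \<and> card e = 2"
  by (auto simp: customer_edges_def)

end

theory Submission
  imports Defs "HOL-Library.FuncSet"
begin

text \<open>
  Two customers with the same score are false twins in the customer graph: they are not
  adjacent, and every other vertex is joined to both with the same weight. Hence their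
  contributions to the objective \<open>f\<close> add up without interaction, and both contribute the same when
  placed in the same group. So twins \<open>u\<close>, \<open>v\<close> satisfy
  \<open>f(u copies v) + f(v copies u) = 2 f(x)\<close> (lemma \<open>false_twins_exchange\<close>): over the two
  modifications, each of their two groups is taken once by \<open>u\<close> and once by \<open>v\<close>.
  If \<open>x\<close> is optimal, neither summand on the left exceeds \<open>f(x)\<close>, so both equal it: a
  customer can copy the row of any customer with the same score without losing optimality
  (lemma \<open>copy_row_optimal\<close>).

  To see that copying can be repeated until each score has one group, fix one representative for
  each score and let non-representatives copy the row of their representative. The rows of
  representatives never change, so the number of customers that disagree with their
  representative drops with each step, and an optimal solution that minimizes this number is a
  segmentation solution.
  An optimal solution exists because the feasible 0-1 matrices form a finite non-empty set.
\<close>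

lemma sum_all_pairs_eq_twice_sum_less_pairs:
  fixes g :: "'a::linorder \<Rightarrow> 'a \<Rightarrow> real"
  assumes "finite V" and sym: "\<And>i j. g i j = g j i" and diag: "\<And>i. g i i = 0"
  shows "(\<Sum>i\<in>V. \<Sum>j\<in>V. g i j) = 2 * (\<Sum>(i, j)\<in>{(i, j). i \<in> V \<and> j \<in> V \<and> i < j}. g i j)"
proof -
  let ?L = "{(i, j). i \<in> V \<and> j \<in> V \<and> i < j}"
  let ?U = "{(i, j). i \<in> V \<and> j \<in> V \<and> j < i}"
  let ?D = "{(i, j). i \<in> V \<and> j \<in> V \<and> i = j}"
  have fin: "finite ?L" "finite ?U" "finite ?D"
    by (rule finite_subset[of _ "V \<times> V"]; use \<open>finite V\<close> in auto)+
  have "(\<Sum>i\<in>V. \<Sum>j\<in>V. g i j) = (\<Sum>(i, j)\<in>V \<times> V. g i j)"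
    by (simp add: sum.cartesian_product)
  also have "V \<times> V = ?L \<union> (?U \<union> ?D)"
    by auto
  also have "(\<Sum>(i, j)\<in>?L \<union> (?U \<union> ?D). g i j)
      = (\<Sum>(i, j)\<in>?L. g i j) + ((\<Sum>(i, j)\<in>?U. g i j) + (\<Sum>(i, j)\<in>?D. g i j))"
    using fin by (subst sum.union_disjoint; (subst sum.union_disjoint)?; auto)
  also have "(\<Sum>(i, j)\<in>?D. g i j) = 0"
    by (rule sum.neutral) (auto simp: diag)
  also have "(\<Sum>(i, j)\<in>?U. g i j) = (\<Sum>(i, j)\<in>?L. g i j)"
    by (rule sum.reindex_bij_witness[of _ prod.swap prod.swap]) (auto simp: sym)
  finally show ?thesis
    by simp
qed

text \<open>
  Splitting off \<open>u\<close> and \<open>v\<close>, no pair inside \<open>{u, v}\<close> carries weight. A pair of \<open>u\<close> with an outside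
  vertex \<open>z\<close> and the pair of \<open>v\<close> with \<open>z\<close> have the same coefficient, so what matters is the sum
  of their two values, and over the two modified labellings this sum adds up to twice its
  original value.
\<close>
lemma false_twins_exchange:
  fixes w :: "'a \<Rightarrow> 'a \<Rightarrow> real" and q :: "'b \<Rightarrow> 'b \<Rightarrow> real" and x :: "'a \<Rightarrow> 'b"
  assumes "finite V" "u \<in> V" "v \<in> V" "u \<noteq> v"
    and w_sym: "\<And>i j. w i j = w j i" and q_sym: "\<And>a b. q a b = q b a"
    and twins: "\<And>z. w u z = w v z" and non_adjacent: "w u v = 0"
  defines "f \<equiv> \<lambda>x. \<Sum>i\<in>V. \<Sum>j\<in>V. w i j * q (x i) (x j)"
  shows "f (x(u := x v)) + f (x(v := x u)) = 2 * f x"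
proof -
  define Z where "Z = V - {u, v}"
  have Z: "finite Z" "u \<notin> Z" "v \<notin> Z" and V: "V = insert u (insert v Z)"
    using assms(1-3) by (auto simp: Z_def)
  have zero: "w u u = 0" "w v v = 0" "w v u = 0"
    using twins[of u] twins[of v] non_adjacent w_sym[of u v] by simp_all
  have split: "f y = (\<Sum>i\<in>Z. \<Sum>j\<in>Z. w i j * q (x i) (x j))
      + 2 * (\<Sum>z\<in>Z. w v z * (q (y u) (x z) + q (y v) (x z)))"
    if y: "\<And>z. z \<in> Z \<Longrightarrow> y z = x z" for y
  proof -
    have "(\<Sum>z\<in>Z. w z u * q (y z) (y u)) = (\<Sum>z\<in>Z. w v z * q (y u) (y z))"
      "(\<Sum>z\<in>Z. w z v * q (y z) (y v)) = (\<Sum>z\<in>Z. w v z * q (y v) (y z))"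
      using w_sym[of _ u] w_sym[of _ v] twins q_sym by metis+
    then have "f y = (\<Sum>i\<in>Z. \<Sum>j\<in>Z. w i j * q (y i) (y j))
        + 2 * (\<Sum>z\<in>Z. w v z * (q (y u) (y z) + q (y v) (y z)))"
      using Z \<open>u \<noteq> v\<close> by (simp add: f_def V zero non_adjacent twins sum.distrib distrib_left)
    then show ?thesis
      by (simp add: y)
  qed
  have outside: "(x(u := x v)) z = x z" "(x(v := x u)) z = x z" if "z \<in> Z" for z
    using that Z by auto
  have "f (x(u := x v)) = (\<Sum>i\<in>Z. \<Sum>j\<in>Z. w i j * q (x i) (x j))
      + 2 * (\<Sum>z\<in>Z. w v z * (q (x v) (x z) + q (x v) (x z)))"
    "f (x(v := x u)) = (\<Sum>i\<in>Z. \<Sum>j\<in>Z. w i j * q (x i) (x j))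
      + 2 * (\<Sum>z\<in>Z. w v z * (q (x u) (x z) + q (x u) (x z)))"
    using split[of "x(u := x v)", OF outside(1)] split[of "x(v := x u)", OF outside(2)]
      \<open>u \<noteq> v\<close> by simp_all
  then show ?thesis
    using split[of x] by (simp add: sum.distrib sum_distrib_left algebra_simps)
qed

lemma customer_weight_eq_score:
  assumes "(R i, F i, M i) = (R j, F j, M j)"
  shows "customer_weight R F M i z = customer_weight R F M j z"
  using assms by (simp add: customer_weight_def)

lemma customer_weight_same_score:
  assumes "(R i, F i, M i) = (R j, F j, M j)"
  shows "customer_weight R F M i j = 0"
  using assms by (simp add: customer_weight_def)

text \<open>
  The edge set can be dropped from the objective because pairs that are not joined by an edge
  have weight zero. Counting ordered instead of unordered pairs removes the condition \<open>i < j\<close>,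
  which would force case distinctions on the relative position of two twins.
\<close>
lemma bqo_objective_customer_graph:
  "2 * bqo_objective n k (customer_edges n R F M) (customer_weight R F M) x =
     (\<Sum>i\<in>{1..n}. \<Sum>j\<in>{1..n}. customer_weight R F M i j * (1 - (\<Sum>l=1..k. x i l * x j l)))"
proof -
  let ?g = "\<lambda>i j. customer_weight R F M i j * (1 - (\<Sum>l=1..k. x i l * x j l))"
  let ?P = "{(i, j). i \<in> {1..n} \<and> j \<in> {1..n} \<and> i < j}"
  have edge: "{i, j} \<in> customer_edges n R F M"
    if "i \<in> {1..n}" "j \<in> {1..n}" "i < j" "customer_weight R F M i j \<noteq> 0" for i j
    using that customer_weight_same_score[of R i F M j]
    unfolding customer_edges_def by blast
  have "finite ?P"
    by (rule finite_subset[of _ "{1..n} \<times> {1..n}"]) auto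
  then have "bqo_objective n k (customer_edges n R F M) (customer_weight R F M) x
      = (\<Sum>(i, j)\<in>?P. ?g i j)"
    unfolding bqo_objective_def by (rule sum.mono_neutral_left) (use edge in auto)
  moreover have "(\<Sum>i\<in>{1..n}. \<Sum>j\<in>{1..n}. ?g i j) = 2 * (\<Sum>(i, j)\<in>?P. ?g i j)"
    by (rule sum_all_pairs_eq_twice_sum_less_pairs)
      (simp_all add: customer_weight_same_score,
        simp add: customer_weight_def abs_minus_commute mult.commute)
  ultimately show ?thesis
    by simp
qed

lemma bqo_feasible_copy_row:
  assumes "bqo_feasible n k x" "v \<in> {1..n}"
  shows "bqo_feasible n k (x(u := x v))"
  using assms unfolding bqo_feasible_def by auto

lemma copy_row_optimal:
  assumes opt: "bqo_optimal n k (customer_edges n R F M) (customer_weight R F M) x"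
    and u: "u \<in> {1..n}" and v: "v \<in> {1..n}"
    and score: "(R u, F u, M u) = (R v, F v, M v)"
  shows "bqo_optimal n k (customer_edges n R F M) (customer_weight R F M) (x(u := x v))"
proof (cases "u = v")
  case True
  then show ?thesis
    using opt by simp
next
  case False
  let ?f = "bqo_objective n k (customer_edges n R F M) (customer_weight R F M)"
  let ?q = "\<lambda>a b. 1 - (\<Sum>l=1..k. a l * b l :: real)"
  have q_sym: "?q a b = ?q b a" for a b
    by (simp add: mult.commute)
  have feas: "bqo_feasible n k (x(u := x v))" "bqo_feasible n k (x(v := x u))"
    using opt u v bqo_feasible_copy_row unfolding bqo_optimal_def by blast+
  have "2 * ?f (x(u := x v)) + 2 * ?f (x(v := x u)) = 2 * (2 * ?f x)"
    unfolding bqo_objective_customer_graph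
    by (rule false_twins_exchange[where q = ?q and x = x, OF finite_atLeastAtMost u v False
          customer_weight_sym q_sym customer_weight_eq_score[OF score]
          customer_weight_same_score[OF score]])
  moreover have "?f (x(v := x u)) \<le> ?f x"
    using opt feas(2) unfolding bqo_optimal_def by blast
  ultimately have "?f x \<le> ?f (x(u := x v))"
    by simp
  then show ?thesis
    using opt feas(1) unfolding bqo_optimal_def by (meson order_trans)
qed

text \<open>
  A feasible solution may take arbitrary values outside the index range, so there are infinitely
  many of them; cutting them down to that range leaves finitely many and keeps the objective.
\<close>
lemma bqo_optimal_exists:
  assumes "k \<ge> 1"
  shows "\<exists>x. bqo_optimal n k E w x"
proof -
  let ?f = "bqo_objective n k E w"
  let ?B = "{1..n} \<rightarrow>\<^sub>E ({1..k} \<rightarrow>\<^sub>E {0, 1 :: real})"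
  have "?f ` {x. bqo_feasible n k x} \<subseteq> ?f ` ?B"
  proof (intro image_subsetI)
    fix x assume "x \<in> {x. bqo_feasible n k x}"
    then have "(\<lambda>i\<in>{1..n}. \<lambda>l\<in>{1..k}. x i l) \<in> ?B"
      unfolding bqo_feasible_def by auto
    moreover have "?f x = ?f (\<lambda>i\<in>{1..n}. \<lambda>l\<in>{1..k}. x i l)"
      unfolding bqo_objective_def by (rule sum.cong) auto
    ultimately show "?f x \<in> ?f ` ?B"
      by blast
  qed
  then have fin: "finite (?f ` {x. bqo_feasible n k x})"
    by (rule finite_subset) (intro finite_imageI finite_PiE; simp)
  have "bqo_feasible n k (\<lambda>i l. if l = 1 then 1 else 0)"
    using \<open>k \<ge> 1\<close> by (simp add: bqo_feasible_def)
  then have "?f ` {x. bqo_feasible n k x} \<noteq> {}"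
    by blast
  from Max_in[OF fin this] obtain x where
    "bqo_feasible n k x" "?f x = Max (?f ` {x. bqo_feasible n k x})"
    by auto
  moreover have "?f y \<le> Max (?f ` {x. bqo_feasible n k x})" if "bqo_feasible n k y" for y
    using that fin by (intro Max_ge) auto
  ultimately show ?thesis
    unfolding bqo_optimal_def by auto
qed

theorem theorem1:
  fixes n T k :: nat and R F M :: "nat \<Rightarrow> nat"
  assumes "n \<ge> 1" and "T \<ge> 1" and "k \<ge> 2"
    and "\<forall>i\<in>{1..n}. R i \<in> {1..T} \<and> F i \<in> {1..T} \<and> M i \<in> {1..T}"
  shows "\<exists>x. bqo_optimal n k (customer_edges n R F M) (customer_weight R F M) x \<and>
             segmentation_solution n k R F M x"
proof -
  let ?opt = "bqo_optimal n k (customer_edges n R F M) (customer_weight R F M)"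
  define score where "score i = (R i, F i, M i)" for i
  define rep where "rep i = (LEAST j. j \<in> {1..n} \<and> score j = score i)" for i
  have rep: "rep i \<in> {1..n} \<and> score (rep i) = score i" if "i \<in> {1..n}" for i
    unfolding rep_def by (rule LeastI[of _ i]) (use that in simp)
  have rep_cong: "rep i = rep j" if "score i = score j" for i j
    using that by (simp add: rep_def)
  define bad where "bad x = {i \<in> {1..n}. x i \<noteq> x (rep i)}" for x :: "nat \<Rightarrow> nat \<Rightarrow> real"
  obtain x0 where "?opt x0"
    using bqo_optimal_exists[of k] \<open>k \<ge> 2\<close> by fastforce
  then obtain x where x: "?opt x" and least: "\<And>y. ?opt y \<Longrightarrow> card (bad x) \<le> card (bad y)"
    using ex_has_least_nat[of ?opt x0 "\<lambda>x. card (bad x)"] by blast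
  have "bad x = {}"
  proof (rule ccontr)
    assume "bad x \<noteq> {}"
    then obtain u where u: "u \<in> {1..n}" "x u \<noteq> x (rep u)"
      by (auto simp: bad_def)
    let ?y = "x(u := x (rep u))"
    have "?opt ?y"
      using copy_row_optimal[OF x u(1)] rep[OF u(1)] by (simp add: score_def)
    \<comment> \<open>\<open>u\<close> is not its own representative, hence nobody's, so no other customer becomes bad.\<close>
    have "rep i \<noteq> u" if "i \<in> {1..n}" for i
      using rep[OF that] rep_cong[of "rep i" i] u(2) by auto
    then have "bad ?y = bad x - {u}"
      using u(1) by (auto simp: bad_def)
    then have "card (bad ?y) < card (bad x)"
      using u by (intro psubset_card_mono) (auto simp: bad_def)
    then show False
      using least[OF \<open>?opt ?y\<close>] by simp
  qed
  then have "x i = x j" if "i \<in> {1..n}" "j \<in> {1..n}" "score i = score j" for i j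
    using that rep_cong[of i j] by (auto simp: bad_def)
  then have "segmentation_solution n k R F M x"
    using x unfolding segmentation_solution_def bqo_optimal_def score_def by metis
  with x show ?thesis
    by blast
qed

end
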